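(* Let $G$ be an infinite simple graph on countably many vertices labeled by $\mathbb{N}$, let $\Lambda\subset\mathbb{R}$ be compact and infinite, and let $T$ be a constructed solution of the SISP with data $(G,\Lambda)$ (as defined in the context). Then $\sigma_{\mathrm{ess}}(T)=\Lambda'$, where $\Lambda'$ is the set of limit points of $\Lambda$.
   Context: All matrices are real. For a symmetric matrix $A$ (finite, or infinite and indexed by $\mathbb{N}$), a simple graph $G$ is the graph of $A$ when for all $i\ne j$, $A_{ij}\neq 0$ if and only if $i$ and $j$ are adjacent in $G$. $G[S]$ is the subgraph of $G$ induced on $S$. A finite symmetric matrix $A$ has the Weak Spectral Property (WSP) if $X=O$ is the only symmetric matrix $X$ of the same size with $X\circ I=O$ (entrywise product, i.e. $X$ has zero diagonal) and $XA-AX=O$. Constructed solution of the SISP (structured inverse spectrum problem) with data $(G,\Lambda)$: choose a countable dense subset $\{\lambda_1,\lambda_2,\dots\}$ of $\Lambda$, enumerated without repetition. Choose $n\times n$ real symmetric matrices $\widetilde A_n$, $n\ge 1$, with $\widetilde A_1=[\lambda_1]$, such that for every $n$: the graph of $\widetilde A_n$ is $G[\{1,\dots,n\}]$; the spectrum of $\widetilde A_n$ is $\{\lambda_1,\dots,\lambda_n\}$; $\widetilde A_n$ has the WSP; $\widetilde A_{n+1}$ is obtained from $\widetilde A_n\oplus[\lambda_{n+1}]$ by changing only diagonal entries and the off-diagonal entries in the last row and last column; and $\|\widetilde A_n\oplus[\lambda_{n+1}]-\widetilde A_{n+1}\|_{\mathrm{op}}<2^{-n}$, where $\|\cdot\|_{\mathrm{op}}$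 is the operator norm. Let $T_n$ be the bounded operator on $\ell^2(\mathbb{N})$ whose matrix in the standard basis is $\widetilde A_n\oplus\operatorname{diag}(\lambda_{n+1},\lambda_{n+2},\dots)$. The sequence $(T_n)$ converges in operator norm, and $T=\lim_{n\to\infty}T_n$ is called a constructed solution of the SISP with data $(G,\Lambda)$ (relative to $\{\lambda_1,\lambda_2,\dots\}$). The essential spectrum is $\sigma_{\mathrm{ess}}(T)=\{\lambda\in\mathbb{C}\mid T-\lambda I\text{ is not a Fredholm operator}\}$; for self-adjoint $T$ this equals $\sigma(T)\setminus\sigma_{\mathrm{discr}}(T)$, where $\sigma_{\mathrm{discr}}(T)$ is the set of isolated eigenvalues of $T$ of finite multiplicity. *)

theory Defs
  imports "HOL-Analysis.Analysis" "Jordan_Normal_Form.Spectral_Radius"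
begin

no_notation inner (infix "\<bullet>" 70)
no_notation Finite_Cartesian_Product.vec_nth (infixl "$" 90)

typedef ell2 = "{x :: nat \<Rightarrow> complex. summable (\<lambda>n. (cmod (x n))\<^sup>2)}"
  morphisms ell2_nth Abs_ell2
  by (rule exI[of _ "\<lambda>_. 0"]) simp

setup_lifting type_definition_ell2

lemma summable_ell2: "summable (\<lambda>n. (cmod (ell2_nth x n))\<^sup>2)"
  using ell2_nth[of x] by simp

lemma ell2_eqI: "(\<And>n. ell2_nth x n = ell2_nth y n) \<Longrightarrow> x = y"
  using ell2_nth_inject by blast

lemma cmod_add_sq_le: "(cmod (a + b))\<^sup>2 \<le> 2 * (cmod a)\<^sup>2 + 2 * (cmod b)\<^sup>2"
proof -
  have "(cmod (a + b))\<^sup>2 \<le> (cmod a + cmod b)\<^sup>2"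
    by (intro power_mono norm_triangle_ineq) auto
  also have "\<dots> \<le> 2 * (cmod a)\<^sup>2 + 2 * (cmod b)\<^sup>2"
    using sum_squares_bound[of "cmod a" "cmod b"] by (simp add: power2_sum)
  finally show ?thesis .
qed

lemma summable_ell2_add:
  assumes "summable (\<lambda>n. (cmod (x n))\<^sup>2)" "summable (\<lambda>n. (cmod (y n))\<^sup>2)"
  shows "summable (\<lambda>n. (cmod (x n + y n))\<^sup>2)"
proof (rule summable_comparison_test')
  show "summable (\<lambda>n. 2 * (cmod (x n))\<^sup>2 + 2 * (cmod (y n))\<^sup>2)"
    by (intro summable_add summable_mult assms)
  show "norm ((cmod (x n + y n))\<^sup>2) \<le> 2 * (cmod (x n))\<^sup>2 + 2 * (cmod (y n))\<^sup>2" if "n \<ge> 0" for n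
    using cmod_add_sq_le by simp
qed

lemma summable_ell2_scale:
  assumes "summable (\<lambda>n. (cmod (x n))\<^sup>2)"
  shows "summable (\<lambda>n. (cmod (c * x n))\<^sup>2)"
  using summable_mult[OF assms, of "(cmod c)\<^sup>2"] by (simp add: norm_mult power_mult_distrib)

lemma summable_ell2_inner: "summable (\<lambda>n. inner (ell2_nth x n) (ell2_nth y n))"
proof (rule summable_comparison_test')
  show "summable (\<lambda>n. (cmod (ell2_nth x n))\<^sup>2 + (cmod (ell2_nth y n))\<^sup>2)"
    by (intro summable_add summable_ell2)
  show "norm (inner (ell2_nth x n) (ell2_nth y n)) \<le>
      (cmod (ell2_nth x n))\<^sup>2 + (cmod (ell2_nth y n))\<^sup>2" if "n \<ge> 0" for n
  proof -
    have "norm (inner (ell2_nth x n) (ell2_nth y n)) \<le> cmod (ell2_nth x n) * cmod (ell2_nth y n)"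
      using Cauchy_Schwarz_ineq2 by simp
    also have "\<dots> \<le> (cmod (ell2_nth x n))\<^sup>2 + (cmod (ell2_nth y n))\<^sup>2"
      using sum_squares_bound[of "cmod (ell2_nth x n)" "cmod (ell2_nth y n)"]
      and mult_nonneg_nonneg[OF norm_ge_zero[of "ell2_nth x n"] norm_ge_zero[of "ell2_nth y n"]]
      by linarith
    finally show ?thesis .
  qed
qed

lift_definition scaleC_ell2 :: "complex \<Rightarrow> ell2 \<Rightarrow> ell2" (infixr "*\<^sub>C" 75)
  is "\<lambda>c x n. c * x n"
  by (rule summable_ell2_scale)

instantiation ell2 :: real_vector
begin

lift_definition zero_ell2 :: ell2 is "\<lambda>_. 0" by simp

lift_definition plus_ell2 :: "ell2 \<Rightarrow> ell2 \<Rightarrow> ell2" is "\<lambda>x y n. x n + y n"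
  by (rule summable_ell2_add)

lift_definition uminus_ell2 :: "ell2 \<Rightarrow> ell2" is "\<lambda>x n. - x n" by simp

definition minus_ell2 :: "ell2 \<Rightarrow> ell2 \<Rightarrow> ell2" where "minus_ell2 x y = x + - y"

definition scaleR_ell2 :: "real \<Rightarrow> ell2 \<Rightarrow> ell2" where "scaleR_ell2 r x = complex_of_real r *\<^sub>C x"

instance
  by standard
    ((simp only: minus_ell2_def)?, rule ell2_eqI,
      simp add: scaleR_ell2_def plus_ell2.rep_eq zero_ell2.rep_eq uminus_ell2.rep_eq
        scaleC_ell2.rep_eq distrib_left distrib_right)+

end

instantiation ell2 :: real_inner
begin

text \<open>The real part of the usual complex inner product: on \<^typ>\<open>complex\<close>,
  \<^term>\<open>inner z w\<close> is the real part of \<^term>\<open>z * cnj w\<close>.\<close>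

definition inner_ell2 :: "ell2 \<Rightarrow> ell2 \<Rightarrow> real"
  where "inner_ell2 x y = (\<Sum>n. inner (ell2_nth x n) (ell2_nth y n))"

definition norm_ell2 :: "ell2 \<Rightarrow> real"
  where "norm_ell2 x = sqrt (\<Sum>n. (cmod (ell2_nth x n))\<^sup>2)"

definition dist_ell2 :: "ell2 \<Rightarrow> ell2 \<Rightarrow> real" where "dist_ell2 x y = norm (x - y)"

definition sgn_ell2 :: "ell2 \<Rightarrow> ell2" where "sgn_ell2 x = x /\<^sub>R norm x"

definition uniformity_ell2 :: "(ell2 \<times> ell2) filter"
  where "uniformity_ell2 = (INF e\<in>{0<..}. principal {(x, y). dist x y < e})"

definition open_ell2 :: "ell2 set \<Rightarrow> bool"
  where "open_ell2 U \<longleftrightarrow> (\<forall>x\<in>U. \<forall>\<^sub>F (x', y) in uniformity. x' = x \<longrightarrow> y \<in> U)"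

instance
proof
  fix x y z :: ell2 and r :: real
  show "dist x y = norm (x - y)" by (rule dist_ell2_def)
  show "sgn x = x /\<^sub>R norm x" by (rule sgn_ell2_def)
  show "uniformity = (INF e\<in>{0<..}. principal {(x :: ell2, y). dist x y < e})"
    by (rule uniformity_ell2_def)
  show "open U \<longleftrightarrow> (\<forall>x\<in>U. \<forall>\<^sub>F (x', y) in uniformity. x' = x \<longrightarrow> y \<in> U)" for U :: "ell2 set"
    by (rule open_ell2_def)
  show "inner x y = inner y x" unfolding inner_ell2_def by (subst inner_commute) (rule refl)
  show "inner (x + y) z = inner x z + inner y z"
    unfolding inner_ell2_def plus_ell2.rep_eq inner_add_left
    by (intro suminf_add[symmetric] summable_ell2_inner)
  show "inner (r *\<^sub>R x) y = r * inner x y"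
  proof -
    have "inner (ell2_nth (r *\<^sub>R x) n) (ell2_nth y n) = r * inner (ell2_nth x n) (ell2_nth y n)" for n
      unfolding scaleR_ell2_def scaleC_ell2.rep_eq scaleR_conv_of_real[symmetric]
      by (rule inner_scaleR_left)
    then show ?thesis
      unfolding inner_ell2_def by (simp only: suminf_mult[OF summable_ell2_inner])
  qed
  show "0 \<le> inner x x"
    unfolding inner_ell2_def by (intro suminf_nonneg summable_ell2_inner) simp
  show "inner x x = 0 \<longleftrightarrow> x = 0"
  proof
    assume "inner x x = 0"
    then have "inner (ell2_nth x n) (ell2_nth x n) = 0" for n
      unfolding inner_ell2_def
      using suminf_eq_zero_iff[OF summable_ell2_inner[of x x]] inner_ge_zero by blast
    then show "x = 0" by (intro ell2_eqI) (simp add: zero_ell2.rep_eq)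
  qed (simp add: inner_ell2_def zero_ell2.rep_eq)
  show "norm x = sqrt (inner x x)"
    unfolding norm_ell2_def inner_ell2_def power2_norm_eq_inner ..
qed

end

interpretation ell2: vector_space scaleC_ell2
  by standard
    (rule ell2_eqI, simp add: plus_ell2.rep_eq scaleC_ell2.rep_eq distrib_left distrib_right)+

lift_definition unit_ell2 :: "nat \<Rightarrow> ell2" is "\<lambda>j n. if n = j then 1 else 0"
proof -
  fix j
  show "summable (\<lambda>n. (cmod (if n = j then 1 else 0))\<^sup>2)"
    by (rule summable_finite[of "{j}"]) auto
qed

definition bounded_clinear :: "(ell2 \<Rightarrow> ell2) \<Rightarrow> bool" where
  "bounded_clinear T \<longleftrightarrow>
     Vector_Spaces.linear scaleC_ell2 scaleC_ell2 T \<and> bounded_linear T"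

text \<open>The last conjunct says that the range of \<open>T\<close> has finite complex codimension. Closedness of the
  range is part of the usual definition, although for bounded operators on a Hilbert space it follows
  from the finite codimension.\<close>

definition fredholm :: "(ell2 \<Rightarrow> ell2) \<Rightarrow> bool" where
  "fredholm T \<longleftrightarrow> bounded_clinear T
     \<and> (\<exists>B. finite B \<and> {x. T x = 0} = ell2.span B)
     \<and> closed (range T)
     \<and> (\<exists>B. finite B \<and> ell2.span (range T \<union> B) = UNIV)"

definition essential_spectrum :: "(ell2 \<Rightarrow> ell2) \<Rightarrow> complex set" where
  "essential_spectrum T = {z. \<not> fredholm (\<lambda>x. T x - z *\<^sub>C x)}"

text \<open>Vertices and indices are counted from 0, so that \<open>{1, \<dots>, n}\<close> becomes \<open>{0..<n}\<close>. A graph on the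
  vertex set of all natural numbers is given by its adjacency relation.\<close>

definition simple_graph :: "(nat \<Rightarrow> nat \<Rightarrow> bool) \<Rightarrow> bool" where
  "simple_graph G \<longleftrightarrow> symp G \<and> irreflp G"

definition has_induced_graph :: "nat \<Rightarrow> real mat \<Rightarrow> (nat \<Rightarrow> nat \<Rightarrow> bool) \<Rightarrow> bool" where
  "has_induced_graph n A G \<longleftrightarrow> (\<forall>i<n. \<forall>j<n. i \<noteq> j \<longrightarrow> (A $$ (i, j) \<noteq> 0 \<longleftrightarrow> G i j))"

definition weak_spectral_property :: "nat \<Rightarrow> real mat \<Rightarrow> bool" where
  "weak_spectral_property n A \<longleftrightarrow>
     (\<forall>X \<in> carrier_mat n n. transpose_mat X = X \<longrightarrow> (\<forall>i<n. X $$ (i, i) = 0)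
        \<longrightarrow> X * A - A * X = 0\<^sub>m n n \<longrightarrow> X = 0\<^sub>m n n)"

definition mat_opnorm :: "real mat \<Rightarrow> real" where
  "mat_opnorm M =
     (SUP v \<in> {v \<in> carrier_vec (dim_col M). v \<bullet> v \<le> 1}. sqrt ((M *\<^sub>v v) \<bullet> (M *\<^sub>v v)))"

definition append_diag :: "nat \<Rightarrow> real mat \<Rightarrow> real \<Rightarrow> real mat" where
  "append_diag n A c = four_block_mat A (0\<^sub>m n 1) (0\<^sub>m 1 n) (mat 1 1 (\<lambda>_. c))"

text \<open>The entries of the infinite matrix \<open>A \<oplus> diag(lam n, lam (n + 1), \<dots>)\<close>.\<close>

definition diag_extension :: "nat \<Rightarrow> real mat \<Rightarrow> (nat \<Rightarrow> real) \<Rightarrow> nat \<Rightarrow> nat \<Rightarrow> real" where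
  "diag_extension n A lam i j =
     (if i < n \<and> j < n then A $$ (i, j) else if i = j then lam i else 0)"

definition has_matrix :: "(ell2 \<Rightarrow> ell2) \<Rightarrow> (nat \<Rightarrow> nat \<Rightarrow> real) \<Rightarrow> bool" where
  "has_matrix T M \<longleftrightarrow>
     bounded_clinear T \<and> (\<forall>i j. ell2_nth (T (unit_ell2 j)) i = complex_of_real (M i j))"

text \<open>The \<open>spectrum\<close> here consists of the real eigenvalues; since \<open>n\<close> distinct ones are prescribed for an
  \<open>n \<times> n\<close> matrix, there are no others.\<close>

definition constructed_solution ::
  "(nat \<Rightarrow> nat \<Rightarrow> bool) \<Rightarrow> real set \<Rightarrow> (ell2 \<Rightarrow> ell2) \<Rightarrow> bool" where
  "constructed_solution G \<Lambda> T \<longleftrightarrow>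
     (\<exists>(lam :: nat \<Rightarrow> real) (A :: nat \<Rightarrow> real mat) (Ts :: nat \<Rightarrow> ell2 \<Rightarrow> ell2).
        inj lam \<and> range lam \<subseteq> \<Lambda> \<and> \<Lambda> \<subseteq> closure (range lam)
      \<and> A 1 = mat 1 1 (\<lambda>_. lam 0)
      \<and> (\<forall>n\<ge>1. A n \<in> carrier_mat n n
            \<and> transpose_mat (A n) = A n
            \<and> has_induced_graph n (A n) G
            \<and> spectrum (A n) = lam ` {0..<n}
            \<and> weak_spectral_property n (A n)
            \<and> (\<forall>i<Suc n. \<forall>j<Suc n. i \<noteq> j \<longrightarrow> i \<noteq> n \<longrightarrow> j \<noteq> n
                 \<longrightarrow> A (Suc n) $$ (i, j) = append_diag n (A n) (lam n) $$ (i, j))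
            \<and> mat_opnorm (append_diag n (A n) (lam n) - A (Suc n)) < 1 / 2 ^ n
            \<and> has_matrix (Ts n) (diag_extension n (A n) lam))
      \<and> bounded_clinear T
      \<and> (\<lambda>n. onorm (\<lambda>x. Ts n x - T x)) \<longlonglongrightarrow> 0)"

end

theory Submission
  imports Defs
begin

text \<open>The approximants of a constructed solution are all compact perturbations of one diagonal
  operator: the matrix of the \<open>n\<close>-th one agrees with \<open>diag(\<lambda>\<^sub>0, \<lambda>\<^sub>1, \<dots>)\<close> outside a finite block, and they
  converge in norm to \<open>T\<close>. So the result is an instance of Weyl's theorem that compact perturbations
  preserve the essential spectrum, together with the remark that, for distinct \<open>\<lambda>\<^sub>i\<close>, the essential
  spectrum of the diagonal operator consists of the limit points of \<open>{\<lambda>\<^sub>0, \<lambda>\<^sub>1, \<dots>}\<close>, which are those of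
  \<open>\<Lambda>\<close> by density. The two inclusions have direct proofs.

  Suppose that \<open>z\<close> is not a limit point. Then some \<open>\<epsilon> > 0\<close> bounds \<open>|\<lambda>\<^sub>i - z|\<close> from below for all large \<open>i\<close>.
  Choose an approximant \<open>A\<close> closer than \<open>\<epsilon>\<close> to \<open>T\<close>, and let \<open>L\<close> be the diagonal operator with entries
  \<open>\<lambda>\<^sub>i - z\<close> for large \<open>i\<close> and \<open>\<epsilon>\<close> otherwise. The inverse of \<open>L\<close> has norm at most \<open>1/\<epsilon>\<close>, so \<open>L + (T - A)\<close> is
  invertible by Banach's fixed point theorem (\<open>invertible_perturbation\<close>); this needs the completeness
  of the sequence space. Moreover \<open>T - z\<close> agrees with \<open>L + (T - A)\<close> on all vectors whose first \<open>m\<close>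
  coordinates vanish, and an operator that agrees with an invertible one on such a subspace is
  Fredholm (\<open>fredholm_if_agrees_with_invertible\<close>).

  Suppose that \<open>z\<close> is a limit point. Then the columns \<open>W e\<^sub>i\<close> of \<open>W = T - z\<close> are arbitrarily small for
  arbitrarily large \<open>i\<close>, and \<open>W\<close> has a real symmetric matrix. By symmetry the \<open>i\<close>-th coordinate of \<open>W u\<close>
  is at most \<open>\<parallel>u\<parallel> \<parallel>W e\<^sub>i\<parallel>\<close>, so along a sequence of indices with \<open>\<parallel>W e\<^sub>i\<parallel> < 4\<^sup>-\<^sup>k\<close> every vector in the range
  of \<open>W\<close> decays like \<open>4\<^sup>-\<^sup>k\<close>. Vectors that decay only like \<open>2\<^sup>-\<^sup>k\<close> and live on infinitely many disjoint
  infinite sets of such indices are linearly independent modulo the range, which therefore has infinite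
  codimension (\<open>not_fredholm_if_small_columns\<close>).\<close>

section \<open>Coordinates, norm and completeness of the sequence space\<close>

lemma ell2_nth_simps [simp]:
  "ell2_nth 0 i = 0"
  "ell2_nth (x + y) i = ell2_nth x i + ell2_nth y i"
  "ell2_nth (- x) i = - ell2_nth x i"
  "ell2_nth (x - y) i = ell2_nth x i - ell2_nth y i"
  "ell2_nth (c *\<^sub>C x) i = c * ell2_nth x i"
  "ell2_nth (unit_ell2 j) i = (if i = j then 1 else 0)"
  unfolding minus_ell2_def
  by (simp_all add: zero_ell2.rep_eq plus_ell2.rep_eq uminus_ell2.rep_eq scaleC_ell2.rep_eq
      unit_ell2.rep_eq del: add_uminus_conv_diff)

lemma ell2_nth_sum [simp]: "ell2_nth (\<Sum>a\<in>A. f a) i = (\<Sum>a\<in>A. ell2_nth (f a) i)"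
  by (induction A rule: infinite_finite_induct) auto

lemma norm_ell2_power2: "(norm x)\<^sup>2 = (\<Sum>i. (cmod (ell2_nth x i))\<^sup>2)"
  by (simp add: norm_ell2_def suminf_nonneg summable_ell2)

lemma sum_cmod_sq_le_norm: "(\<Sum>i<N. (cmod (ell2_nth x i))\<^sup>2) \<le> (norm x)\<^sup>2"
  unfolding norm_ell2_power2 by (intro sum_le_suminf summable_ell2) auto

lemma cmod_nth_le_norm: "cmod (ell2_nth x i) \<le> norm x"
proof (rule power2_le_imp_le)
  have "(cmod (ell2_nth x i))\<^sup>2 \<le> (\<Sum>k<Suc i. (cmod (ell2_nth x k))\<^sup>2)"
    by (rule member_le_sum) auto
  also have "\<dots> \<le> (norm x)\<^sup>2"
    by (rule sum_cmod_sq_le_norm)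
  finally show "(cmod (ell2_nth x i))\<^sup>2 \<le> (norm x)\<^sup>2" .
qed simp

lemma norm_ell2_leI:
  assumes "\<And>N. (\<Sum>i<N. (cmod (ell2_nth x i))\<^sup>2) \<le> K\<^sup>2" and "0 \<le> K"
  shows "norm x \<le> K"
proof (rule power2_le_imp_le)
  show "(norm x)\<^sup>2 \<le> K\<^sup>2"
    unfolding norm_ell2_power2 using assms(1) by (intro suminf_le_const summable_ell2) auto
qed fact

lemma norm_ell2_mono:
  assumes "\<And>i. cmod (ell2_nth x i) \<le> C * cmod (ell2_nth y i)" and "0 \<le> C"
  shows "norm x \<le> C * norm y"
proof (rule norm_ell2_leI)
  fix N
  have "(\<Sum>i<N. (cmod (ell2_nth x i))\<^sup>2) \<le> (\<Sum>i<N. (C * cmod (ell2_nth y i))\<^sup>2)"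
    by (intro sum_mono power_mono assms) auto
  also have "\<dots> = C\<^sup>2 * (\<Sum>i<N. (cmod (ell2_nth y i))\<^sup>2)"
    by (simp add: power_mult_distrib sum_distrib_left)
  also have "\<dots> \<le> (C * norm y)\<^sup>2"
    unfolding power_mult_distrib by (intro mult_left_mono sum_cmod_sq_le_norm) auto
  finally show "(\<Sum>i<N. (cmod (ell2_nth x i))\<^sup>2) \<le> (C * norm y)\<^sup>2" .
qed (use assms in auto)

lemma norm_scaleC: "norm (c *\<^sub>C x) = cmod c * norm x"
proof -
  have "(norm (c *\<^sub>C x))\<^sup>2 = (cmod c * norm x)\<^sup>2"
    by (simp add: norm_ell2_power2 power_mult_distrib norm_mult suminf_mult summable_ell2)
  then show ?thesis by (simp add: power2_eq_iff_nonneg)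
qed

lemma norm_unit_ell2: "norm (unit_ell2 j) = 1"
proof -
  have "(\<Sum>i. (cmod (ell2_nth (unit_ell2 j) i))\<^sup>2) = (\<Sum>i\<in>{j}. (cmod (ell2_nth (unit_ell2 j) i))\<^sup>2)"
    by (rule suminf_finite) auto
  then have "(norm (unit_ell2 j))\<^sup>2 = 1"
    unfolding norm_ell2_power2 by simp
  then show ?thesis by (simp add: power2_eq_1_iff)
    (smt (verit) norm_ge_zero)
qed

lemma ex_ell2:
  assumes "summable (\<lambda>i. (cmod (f i))\<^sup>2)"
  obtains x where "ell2_nth x = f"
  using assms Abs_ell2_inverse by blast

instance ell2 :: complete_space
proof
  fix X :: "nat \<Rightarrow> ell2"
  assume X: "Cauchy X"
  have "Cauchy (\<lambda>m. ell2_nth (X m) i)" for i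
  proof (rule CauchyI)
    fix e :: real assume "0 < e"
    then obtain M where M: "\<And>m n. m \<ge> M \<Longrightarrow> n \<ge> M \<Longrightarrow> norm (X m - X n) < e"
      using CauchyD[OF X] by meson
    have "cmod (ell2_nth (X m) i - ell2_nth (X n) i) < e" if "m \<ge> M" "n \<ge> M" for m n
      using cmod_nth_le_norm[of "X m - X n" i] M[OF that] by simp
    then show "\<exists>M. \<forall>m\<ge>M. \<forall>n\<ge>M. cmod (ell2_nth (X m) i - ell2_nth (X n) i) < e"
      by blast
  qed
  then have "\<exists>l. (\<lambda>m. ell2_nth (X m) i) \<longlonglongrightarrow> l" for i
    by (simp add: Cauchy_convergent_iff convergent_def)
  then obtain l where l: "\<And>i. (\<lambda>m. ell2_nth (X m) i) \<longlonglongrightarrow> l i"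
    by metis
  \<comment> \<open>Bounding finite sections lets the Cauchy condition pass to the coordinatewise limit.\<close>
  have tail: "\<exists>M. \<forall>m\<ge>M. \<forall>N. (\<Sum>i<N. (cmod (ell2_nth (X m) i - l i))\<^sup>2) \<le> e\<^sup>2" if "0 < e" for e
  proof -
    obtain M where M: "\<And>m n. m \<ge> M \<Longrightarrow> n \<ge> M \<Longrightarrow> norm (X m - X n) < e"
      using CauchyD[OF X \<open>0 < e\<close>] by meson
    have "(\<Sum>i<N. (cmod (ell2_nth (X m) i - l i))\<^sup>2) \<le> e\<^sup>2" if "m \<ge> M" for m N
    proof (rule LIMSEQ_le_const2)
      show "(\<lambda>n. \<Sum>i<N. (cmod (ell2_nth (X m) i - ell2_nth (X n) i))\<^sup>2)
          \<longlonglongrightarrow> (\<Sum>i<N. (cmod (ell2_nth (X m) i - l i))\<^sup>2)"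
        by (intro tendsto_intros l)
      have "(\<Sum>i<N. (cmod (ell2_nth (X m) i - ell2_nth (X n) i))\<^sup>2) \<le> e\<^sup>2" if "n \<ge> M" for n
      proof -
        have "(norm (X m - X n))\<^sup>2 \<le> e\<^sup>2"
          using M[OF \<open>m \<ge> M\<close> that] by (intro power_mono) auto
        then show ?thesis
          using sum_cmod_sq_le_norm[of "X m - X n" N] by simp
      qed
      then show "\<exists>K. \<forall>n\<ge>K. (\<Sum>i<N. (cmod (ell2_nth (X m) i - ell2_nth (X n) i))\<^sup>2) \<le> e\<^sup>2"
        by blast
    qed
    then show ?thesis by blast
  qed
  obtain M where "\<And>N. (\<Sum>i<N. (cmod (ell2_nth (X M) i - l i))\<^sup>2) \<le> 1"
    using tail[of 1] by auto
  then have "summable (\<lambda>i. (cmod (ell2_nth (X M) i - l i))\<^sup>2)"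
    by (intro summableI_nonneg_bounded) auto
  then obtain d where d: "ell2_nth d = (\<lambda>i. ell2_nth (X M) i - l i)"
    by (rule ex_ell2)
  define L where "L = X M - d"
  have L: "ell2_nth L i = l i" for i
    by (simp add: L_def d)
  have "X \<longlonglongrightarrow> L"
  proof (rule LIMSEQ_I)
    fix r :: real assume "0 < r"
    then obtain M where M: "\<And>m N. m \<ge> M \<Longrightarrow> (\<Sum>i<N. (cmod (ell2_nth (X m) i - l i))\<^sup>2) \<le> (r / 2)\<^sup>2"
      using tail[of "r / 2"] by auto
    have "norm (X m - L) < r" if "m \<ge> M" for m
      using norm_ell2_leI[of "X m - L" "r / 2"] M[OF that] \<open>0 < r\<close> by (simp add: L)
    then show "\<exists>no. \<forall>n\<ge>no. norm (X n - L) < r" by blast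
  qed
  then show "convergent X" by (auto simp: convergent_def)
qed

section \<open>Bounded complex-linear operators\<close>

lemma bounded_clinearI:
  assumes "\<And>x y. T (x + y) = T x + T y" and "\<And>c x. T (c *\<^sub>C x) = c *\<^sub>C T x"
    and "\<And>x. norm (T x) \<le> K * norm x"
  shows "bounded_clinear T"
proof -
  have "bounded_linear T"
    using assms by (intro bounded_linear_intro[where K = K]) (auto simp: scaleR_ell2_def mult.commute)
  then show ?thesis
    unfolding bounded_clinear_def Vector_Spaces.linear_iff
    using assms ell2.vector_space_axioms by auto
qed

lemma
  assumes "bounded_clinear T"
  shows bounded_clinear_add: "T (x + y) = T x + T y"
    and bounded_clinear_scaleC: "T (c *\<^sub>C x) = c *\<^sub>C T x"
    and bounded_clinear_bounded_linear: "bounded_linear T"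
  using assms unfolding bounded_clinear_def Vector_Spaces.linear_iff by auto

lemma
  assumes "bounded_clinear T"
  shows bounded_clinear_diff: "T (x - y) = T x - T y"
    and bounded_clinear_sum: "T (\<Sum>a\<in>A. f a) = (\<Sum>a\<in>A. T (f a))"
    and bounded_clinear_zero: "T 0 = 0"
  using bounded_clinear_bounded_linear[OF assms, THEN bounded_linear.linear]
  by (simp_all add: linear_diff linear_sum linear_0)

lemma bounded_clinear_if_bounded_linear:
  assumes "\<And>x y. T (x + y) = T x + T y" and "\<And>c x. T (c *\<^sub>C x) = c *\<^sub>C T x"
    and "bounded_linear T"
  shows "bounded_clinear T"
proof -
  obtain K where "norm (T x) \<le> norm x * K" for x
    using bounded_linear.bounded[OF assms(3)] by blast
  then show ?thesis
    using assms(1,2) by (intro bounded_clinearI[where K = K]) (simp_all add: mult.commute)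
qed

lemma bounded_clinear_sub:
  assumes "bounded_clinear S" "bounded_clinear T"
  shows "bounded_clinear (\<lambda>x. S x - T x)"
  using assms
  by (intro bounded_clinear_if_bounded_linear bounded_linear_sub)
    (simp_all add: bounded_clinear_add bounded_clinear_scaleC bounded_clinear_bounded_linear
      ell2.scale_right_diff_distrib)

lemma bounded_clinear_compose:
  assumes "bounded_clinear S" "bounded_clinear T"
  shows "bounded_clinear (\<lambda>x. S (T x))"
  using assms
  by (intro bounded_clinear_if_bounded_linear bounded_linear_compose[of S T])
    (simp_all add: bounded_clinear_add bounded_clinear_scaleC bounded_clinear_bounded_linear)

lemma bounded_clinear_scaleC_right: "bounded_clinear (\<lambda>x. z *\<^sub>C x)"
  by (rule bounded_clinearI[where K = "cmod z"])
    (simp_all add: ell2.scale_right_distrib ell2.scale_left_commute norm_scaleC)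

lemma bounded_linear_ell2_nth: "bounded_linear (\<lambda>x. ell2_nth x i)"
  by (rule bounded_linear_intro[where K = 1])
    (simp_all add: scaleR_ell2_def scaleR_conv_of_real cmod_nth_le_norm)

definition trunc_ell2 :: "nat \<Rightarrow> ell2 \<Rightarrow> ell2" where
  "trunc_ell2 m x = (\<Sum>i<m. ell2_nth x i *\<^sub>C unit_ell2 i)"

lemma ell2_nth_trunc [simp]: "ell2_nth (trunc_ell2 m x) i = (if i < m then ell2_nth x i else 0)"
proof -
  have "ell2_nth (trunc_ell2 m x) i = (\<Sum>k<m. if k = i then ell2_nth x i else 0)"
    unfolding trunc_ell2_def ell2_nth_sum by (rule sum.cong) auto
  then show ?thesis by simp
qed

lemma bounded_clinear_trunc: "bounded_clinear (trunc_ell2 m)"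
proof (rule bounded_clinearI)
  show "norm (trunc_ell2 m x) \<le> 1 * norm x" for x
    by (rule norm_ell2_mono) auto
qed (auto intro!: ell2_eqI)

lemma apply_trunc:
  assumes "bounded_clinear T"
  shows "T (trunc_ell2 m x) = (\<Sum>i<m. ell2_nth x i *\<^sub>C T (unit_ell2 i))"
  unfolding trunc_ell2_def
  by (simp add: bounded_clinear_sum[OF assms] bounded_clinear_scaleC[OF assms])

lemma trunc_ell2_tendsto: "(\<lambda>m. trunc_ell2 m x) \<longlonglongrightarrow> x"
proof -
  let ?f = "\<lambda>i. (cmod (ell2_nth x i))\<^sup>2"
  have sq: "(norm (trunc_ell2 m x - x))\<^sup>2 = (\<Sum>i. ?f i) - (\<Sum>i<m. ?f i)" for m
  proof -
    have "(norm (trunc_ell2 m x - x))\<^sup>2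
        = (\<Sum>i. ?f i - (if i \<in> {..<m} then ?f i else 0))"
      unfolding norm_ell2_power2 by (intro suminf_cong) auto
    also have "\<dots> = (\<Sum>i. ?f i) - (\<Sum>i. if i \<in> {..<m} then ?f i else 0)"
      by (intro suminf_diff[symmetric] summable_ell2 summable_If_finite_set) auto
    also have "(\<Sum>i. if i \<in> {..<m} then ?f i else 0) = (\<Sum>i<m. ?f i)"
      using suminf_finite[of "{..<m}" "\<lambda>i. if i \<in> {..<m} then ?f i else 0"] by simp
    finally show ?thesis .
  qed
  have "(\<lambda>m. (\<Sum>i. ?f i) - (\<Sum>i<m. ?f i)) \<longlonglongrightarrow> (\<Sum>i. ?f i) - (\<Sum>i. ?f i)"
    by (intro tendsto_intros summable_LIMSEQ summable_ell2)
  then have "(\<lambda>m. sqrt ((norm (trunc_ell2 m x - x))\<^sup>2)) \<longlonglongrightarrow> sqrt 0"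
    unfolding sq by (intro tendsto_intros) simp
  then show ?thesis
    by (simp add: tendsto_norm_zero_iff LIM_zero_iff)
qed

lemma bounded_clinear_nth_sums:
  assumes "bounded_clinear T"
  shows "(\<lambda>j. ell2_nth x j * ell2_nth (T (unit_ell2 j)) i) sums ell2_nth (T x) i"
proof -
  have "(\<lambda>m. ell2_nth (T (trunc_ell2 m x)) i) \<longlonglongrightarrow> ell2_nth (T x) i"
    using bounded_clinear_bounded_linear[OF assms]
    by (intro bounded_linear.tendsto[OF bounded_linear_ell2_nth]
        bounded_linear.tendsto[of T] trunc_ell2_tendsto)
  then show ?thesis
    by (simp add: sums_def apply_trunc[OF assms])
qed

section \<open>Finite-dimensional subspaces\<close>

text \<open>A finite orthogonal generating set describes the span by the equation that a vector equals its
  orthogonal projection, and both sides of this equation are continuous.\<close>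

lemma closed_span_finite:
  fixes B :: "'a::real_inner set"
  assumes "finite B"
  shows "closed (span B)"
proof -
  obtain C where C: "finite C" "span C = span B" "pairwise Linear_Algebra.orthogonal C"
    using basis_orthogonal[OF assms] by blast
  define proj where "proj x = (\<Sum>c\<in>C. (inner x c / inner c c) *\<^sub>R c)" for x
  have "linear proj"
    unfolding proj_def
    by (intro linearI)
      (simp_all add: inner_add_left add_divide_distrib scaleR_add_left sum.distrib scaleR_sum_right)
  then have "Real_Vector_Spaces.subspace {x. proj x = x}"
    unfolding Real_Vector_Spaces.subspace_def by (simp add: linear_0 linear_add linear_scale)
  moreover have "proj b = b" if "b \<in> C" for b
  proof -
    have "proj b = (\<Sum>c\<in>{b}. (inner b c / inner c c) *\<^sub>R c)"
      unfolding proj_def using C that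
      by (intro sum.mono_neutral_right) (auto simp: pairwise_def Linear_Algebra.orthogonal_def)
    then show ?thesis by simp
  qed
  ultimately have "span C \<subseteq> {x. proj x = x}"
    by (intro span_minimal) auto
  moreover have "proj x \<in> span C" for x
    unfolding proj_def by (intro span_sum span_scale span_base)
  then have "{x. proj x = x} \<subseteq> span C"
    by (metis (mono_tags, lifting) mem_Collect_eq subsetI)
  ultimately have "span C = {x. proj x = x}"
    by blast
  moreover have "closed {x. proj x = x}"
    unfolding proj_def divide_inverse by (intro closed_Collect_eq continuous_intros)
  ultimately show ?thesis by (simp add: C)
qed

text \<open>The complex span of \<open>B\<close> is the real span of \<open>B\<close> and \<open>\<i>B\<close>, so the real case applies.\<close>

lemma closed_complex_span_finite:
  assumes "finite B"
  shows "closed (ell2.span B)"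
proof -
  let ?B = "B \<union> (\<lambda>b. \<i> *\<^sub>C b) ` B"
  have i: "\<i> *\<^sub>C x \<in> span ?B" if "x \<in> span ?B" for x
    using that
  proof (induction rule: span_induct_alt)
    case base
    show ?case by (simp add: span_zero)
  next
    case (step r x y)
    have "\<i> *\<^sub>C x \<in> span ?B"
    proof (cases "x \<in> B")
      case True
      then show ?thesis by (intro span_base) auto
    next
      case False
      then obtain b where "b \<in> B" "x = \<i> *\<^sub>C b" using step by auto
      then have "\<i> *\<^sub>C x = - b" by (intro ell2_eqI) simp
      then show ?thesis using \<open>b \<in> B\<close> by (simp add: span_neg span_base)
    qed
    moreover have "\<i> *\<^sub>C (r *\<^sub>R x + y) = r *\<^sub>R (\<i> *\<^sub>C x) + \<i> *\<^sub>C y"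
      by (intro ell2_eqI) (simp add: scaleR_ell2_def algebra_simps)
    ultimately show ?case using step by (simp add: span_add span_scale)
  qed
  have "ell2.subspace (span ?B)"
  proof (rule ell2.subspaceI)
    fix c x assume "x \<in> span ?B"
    moreover have "c *\<^sub>C x = Re c *\<^sub>R x + Im c *\<^sub>R (\<i> *\<^sub>C x)"
      by (intro ell2_eqI) (simp add: scaleR_ell2_def complex_eq_iff)
    ultimately show "c *\<^sub>C x \<in> span ?B"
      by (simp add: i span_add span_scale)
  qed (auto simp: span_zero span_add)
  then have "ell2.span B \<subseteq> span ?B"
    by (intro ell2.span_minimal) (auto intro: span_base)
  moreover have "Real_Vector_Spaces.subspace (ell2.span B)"
    unfolding Real_Vector_Spaces.subspace_def
    by (auto simp: scaleR_ell2_def ell2.span_zero ell2.span_add ell2.span_scale)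
  then have "span ?B \<subseteq> ell2.span B"
    by (intro span_minimal) (auto intro: ell2.span_base ell2.span_scale)
  ultimately have "ell2.span B = span ?B" by blast
  then show ?thesis using assms by (simp add: closed_span_finite)
qed

lemma subspace_finite_basis:
  assumes "ell2.subspace V" "V \<subseteq> ell2.span F" "finite F"
  shows "\<exists>B. finite B \<and> V = ell2.span B"
proof -
  obtain B where B: "B \<subseteq> V" "ell2.independent B" "V \<subseteq> ell2.span B"
    by (rule ell2.maximal_independent_subset)
  then have "finite B"
    using ell2.independent_span_bound[of F B] assms by auto
  then show ?thesis
    using B assms(1) ell2.span_minimal by blast
qed

text \<open>A finite \<open>B\<close> that generates everything modulo \<open>R\<close> would have to accommodate the \<open>B\<close>-components of all
  the \<open>y j\<close>; these inherit linear independence from the independence of the \<open>y j\<close> modulo \<open>R\<close>.\<close>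

lemma infinite_codimension:
  fixes y :: "nat \<Rightarrow> ell2"
  assumes R: "ell2.subspace R"
    and y: "\<And>J c j. finite J \<Longrightarrow> (\<Sum>j\<in>J. c j *\<^sub>C y j) \<in> R \<Longrightarrow> j \<in> J \<Longrightarrow> c j = 0"
    and "finite B"
  shows "ell2.span (R \<union> B) \<noteq> UNIV"
proof
  assume "ell2.span (R \<union> B) = UNIV"
  then have "\<exists>r s. y j = r + s \<and> r \<in> R \<and> s \<in> ell2.span B" for j
    unfolding ell2.span_Un using R
    by (smt (verit) UNIV_I mem_Collect_eq ell2.span_eq_iff)
  then obtain r s where rs: "\<And>j. y j = r j + s j" "\<And>j. r j \<in> R" "\<And>j. s j \<in> ell2.span B"
    by metis
  have "inj s"
  proof (rule injI, rule ccontr)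
    fix i j assume ij: "s i = s j" "i \<noteq> j"
    define c :: "nat \<Rightarrow> complex" where "c k = (if k = i then 1 else - 1)" for k
    have "(\<Sum>k\<in>{i, j}. c k *\<^sub>C y k) = r i - r j"
      using ij by (intro ell2_eqI) (simp add: c_def rs)
    then have "c i = 0"
      using ij R rs by (intro y[of "{i, j}"]) (auto simp: ell2.subspace_diff)
    then show False by (simp add: c_def)
  qed
  moreover have "ell2.independent (range s)"
    unfolding ell2.independent_explicit_finite_subsets
  proof (intro allI impI ballI)
    fix S u v assume S: "S \<subseteq> range s" "finite S" "(\<Sum>v\<in>S. u v *\<^sub>C v) = 0" "v \<in> S"
    obtain J where J: "finite J" "S = s ` J"
      using finite_subset_image[of S s UNIV] S by auto
    have "(\<Sum>j\<in>J. u (s j) *\<^sub>C s j) = 0"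
      using S J sum.reindex[OF inj_on_subset[OF \<open>inj s\<close> subset_UNIV], of "\<lambda>v. u v *\<^sub>C v" J]
      by simp
    then have "(\<Sum>j\<in>J. u (s j) *\<^sub>C y j) = (\<Sum>j\<in>J. u (s j) *\<^sub>C r j)"
      by (simp add: rs(1) ell2.scale_right_distrib sum.distrib)
    then have "(\<Sum>j\<in>J. u (s j) *\<^sub>C y j) \<in> R"
      using R rs by (simp add: ell2.subspace_sum ell2.subspace_scale)
    then show "u v = 0"
      using y[of J "\<lambda>j. u (s j)"] J S by auto
  qed
  ultimately show False
    using ell2.independent_span_bound[OF \<open>finite B\<close>, of "range s"] rs(3) range_inj_infinite
    by blast
qed

section \<open>Finite-codimensional perturbations of invertible operators\<close>

text \<open>The equation \<open>L x + E x = y\<close> says that \<open>x\<close> is a fixed point of \<open>x \<mapsto> R (y - E x)\<close>, where \<open>R\<close> is the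
  inverse of \<open>L\<close>. This map contracts by the factor \<open>\<delta> / \<epsilon>\<close>.\<close>

lemma invertible_perturbation:
  assumes L: "bounded_clinear L" and R: "bounded_clinear R"
    and LR: "\<And>x. L (R x) = x" and RL: "\<And>x. R (L x) = x"
    and R_le: "\<And>x. \<epsilon> * norm (R x) \<le> norm x"
    and E: "bounded_clinear E" and E_le: "\<And>x. norm (E x) \<le> \<delta> * norm x"
    and \<delta>: "0 \<le> \<delta>" "\<delta> < \<epsilon>"
  shows "\<exists>S'. bounded_clinear S' \<and> (\<forall>y. L (S' y) + E (S' y) = y) \<and> (\<forall>x. S' (L x + E x) = x)"
proof -
  have fix_iff: "R (y - E x) = x \<longleftrightarrow> L x + E x = y" for x y
    by (metis LR RL add_diff_cancel_right' diff_add_cancel)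
  have ex1: "\<exists>!x. L x + E x = y" for y
    unfolding fix_iff[symmetric]
  proof (rule banach_fix_type)
    show "0 \<le> \<delta> / \<epsilon>" "\<delta> / \<epsilon> < 1" using \<delta> by auto
    show "\<forall>x z. dist (R (y - E x)) (R (y - E z)) \<le> \<delta> / \<epsilon> * dist x z"
    proof (intro allI)
      fix x z
      have "R (y - E x) - R (y - E z) = R (E (z - x))"
        by (simp add: bounded_clinear_diff[OF R] bounded_clinear_diff[OF E])
      moreover have "\<epsilon> * norm (R (E (z - x))) \<le> \<delta> * norm (z - x)"
        using R_le E_le order_trans by blast
      ultimately show "dist (R (y - E x)) (R (y - E z)) \<le> \<delta> / \<epsilon> * dist x z"
        using \<delta> by (simp add: dist_norm field_simps norm_minus_commute)
    qed
  qed
  define S' where "S' y = (THE x. L x + E x = y)" for y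
  have S': "L (S' y) + E (S' y) = y" for y
    unfolding S'_def by (rule theI'[OF ex1])
  have S'_eq: "S' y = x" if "L x + E x = y" for x y
    using ex1 S' that by blast
  have "bounded_clinear S'"
  proof (rule bounded_clinearI)
    show "S' (x + y) = S' x + S' y" for x y
      using S'[of x] S'[of y]
      by (intro S'_eq) (simp add: bounded_clinear_add[OF L] bounded_clinear_add[OF E] algebra_simps)
    show "S' (c *\<^sub>C x) = c *\<^sub>C S' x" for c x
      by (intro S'_eq) (simp add: bounded_clinear_scaleC[OF L] bounded_clinear_scaleC[OF E] S'
          ell2.scale_right_distrib[symmetric])
    show "norm (S' y) \<le> 1 / (\<epsilon> - \<delta>) * norm y" for y
    proof -
      have "\<epsilon> * norm (S' y) \<le> norm (y - E (S' y))"
        using R_le[of "y - E (S' y)"] by (simp add: fix_iff[THEN iffD2, OF S'])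
      also have "\<dots> \<le> norm y + \<delta> * norm (S' y)"
        using norm_triangle_ineq4[of y "E (S' y)"] E_le[of "S' y"] by linarith
      finally show ?thesis using \<delta> by (simp add: field_simps)
    qed
  qed
  then show ?thesis using S' S'_eq by blast
qed

text \<open>Transport the splitting of a vector into its first \<open>m\<close> coordinates and the rest by the
  isomorphism \<open>S\<close>. The image of the second part lies in the range of \<open>W\<close>, and everything else about \<open>W\<close>
  is determined by the finitely many vectors \<open>W e\<^sub>i\<close> with \<open>i < m\<close>. This makes the kernel finite-dimensional
  and the codimension of the range finite. The range is closed because it is the preimage of a
  finite-dimensional space under the bounded projection \<open>\<pi>\<close> that kills the image of the second part.\<close>

lemma fredholm_if_agrees_with_invertible:
  assumes W: "bounded_clinear W" and S: "bounded_clinear S" and S': "bounded_clinear S'"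
    and SS': "\<And>y. S (S' y) = y" and S'S: "\<And>x. S' (S x) = x"
    and agree: "\<And>x. (\<And>i. i < m \<Longrightarrow> ell2_nth x i = 0) \<Longrightarrow> W x = S x"
  shows "fredholm W"
proof -
  note lin = bounded_clinear_add bounded_clinear_diff bounded_clinear_scaleC bounded_clinear_sum
    bounded_clinear_zero
  define tail where "tail x = x - trunc_ell2 m x" for x
  have W_tail: "W (tail x) = S (tail x)" for x
    by (rule agree) (simp add: tail_def)
  have trunc_tail: "trunc_ell2 m (tail x) = 0" for x
    by (rule ell2_eqI) (simp add: tail_def)
  have split: "x = tail x + trunc_ell2 m x" for x
    by (simp add: tail_def)
  let ?e = unit_ell2
  have WS: "W x = S (tail x) + (\<Sum>i<m. ell2_nth x i *\<^sub>C W (?e i))" for x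
    using lin(1)[OF W, of "tail x" "trunc_ell2 m x"] by (simp add: split[symmetric] W_tail apply_trunc[OF W])
  define \<pi> where "\<pi> y = S (trunc_ell2 m (S' y))" for y
  have \<pi>: "bounded_clinear \<pi>"
    unfolding \<pi>_def
    by (rule bounded_clinear_compose[OF S bounded_clinear_compose[OF bounded_clinear_trunc S']])

  have "\<exists>B. finite B \<and> {x. W x = 0} = ell2.span B"
  proof (rule subspace_finite_basis)
    show "ell2.subspace {x. W x = 0}"
      by (rule ell2.subspaceI) (simp_all add: lin[OF W])
    show "{x. W x = 0} \<subseteq> ell2.span ((\<lambda>i. ?e i - S' (W (?e i))) ` {..<m})"
    proof
      fix x assume "x \<in> {x. W x = 0}"
      then have "S (tail x) = 0 - (\<Sum>i<m. ell2_nth x i *\<^sub>C W (?e i))"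
        using WS[of x] by (simp add: eq_neg_iff_add_eq_0)
      then have "S' (S (tail x)) = S' (0 - (\<Sum>i<m. ell2_nth x i *\<^sub>C W (?e i)))"
        by simp
      then have "tail x = - (\<Sum>i<m. ell2_nth x i *\<^sub>C S' (W (?e i)))"
        unfolding S'S lin[OF S'] by simp
      then have "tail x + trunc_ell2 m x = (\<Sum>i<m. ell2_nth x i *\<^sub>C (?e i - S' (W (?e i))))"
        by (simp add: trunc_ell2_def ell2.scale_right_diff_distrib sum_subtractf)
      then have "x = (\<Sum>i<m. ell2_nth x i *\<^sub>C (?e i - S' (W (?e i))))"
        by (simp only: split[symmetric])
      then show "x \<in> ell2.span ((\<lambda>i. ?e i - S' (W (?e i))) ` {..<m})"
        by (metis (no_types, lifting) ell2.span_base ell2.span_scale ell2.span_sum imageI)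
    qed
  qed auto

  moreover have "closed (range W)"
  proof -
    let ?K = "ell2.span ((\<lambda>i. \<pi> (W (?e i))) ` {..<m})"
    have "range W = \<pi> -` ?K"
    proof (intro subset_antisym subsetI)
      fix y assume "y \<in> range W"
      then obtain x where x: "y = W x" by blast
      have "\<pi> (S (tail x)) = 0"
        by (simp add: \<pi>_def S'S trunc_tail lin[OF S])
      then have "\<pi> y = (\<Sum>i<m. ell2_nth x i *\<^sub>C \<pi> (W (?e i)))"
        unfolding x WS[of x] by (simp add: lin[OF \<pi>])
      also have "\<dots> \<in> ?K"
        by (intro ell2.span_sum ell2.span_scale ell2.span_base imageI)
      finally show "y \<in> \<pi> -` ?K" by simp
    next
      fix y assume "y \<in> \<pi> -` ?K"
      moreover have "?K \<subseteq> range (\<lambda>u. \<pi> (W u))"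
      proof (rule ell2.span_minimal)
        show "ell2.subspace (range (\<lambda>u. \<pi> (W u)))"
        proof (rule ell2.subspaceI)
          show "0 \<in> range (\<lambda>u. \<pi> (W u))"
            by (rule range_eqI[of _ _ 0]) (simp add: lin[OF W] lin[OF \<pi>])
          fix a b c assume "a \<in> range (\<lambda>u. \<pi> (W u))"
          then obtain u where u: "a = \<pi> (W u)" by blast
          show "c *\<^sub>C a \<in> range (\<lambda>u. \<pi> (W u))"
            by (rule range_eqI[of _ _ "c *\<^sub>C u"]) (simp add: u lin[OF W] lin[OF \<pi>])
          assume "b \<in> range (\<lambda>u. \<pi> (W u))"
          then obtain v where v: "b = \<pi> (W v)" by blast
          show "a + b \<in> range (\<lambda>u. \<pi> (W u))"
            by (rule range_eqI[of _ _ "u + v"]) (simp add: u v lin[OF W] lin[OF \<pi>])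
        qed
      qed auto
      ultimately obtain u where u: "\<pi> y = \<pi> (W u)" by auto
      define v where "v = S' (y - W u)"
      have "S (trunc_ell2 m v) = 0"
        using u lin(2)[OF \<pi>, of y "W u"] by (simp add: v_def \<pi>_def)
      then have "trunc_ell2 m v = 0"
        by (metis S'S S' bounded_clinear_zero)
      then have "W v = S v"
        using W_tail[of v] by (simp add: tail_def)
      then have "W (u + v) = y"
        by (simp add: lin[OF W] v_def SS')
      then show "y \<in> range W" by blast
    qed
    moreover have "closed (\<pi> -` ?K)"
      using bounded_clinear_bounded_linear[OF \<pi>]
      by (intro closed_vimage closed_complex_span_finite) (auto intro: linear_continuous_on)
    ultimately show ?thesis by simp
  qed

  moreover have "ell2.span (range W \<union> (\<lambda>i. S (?e i)) ` {..<m}) = UNIV"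
  proof -
    have "y \<in> ell2.span (range W \<union> (\<lambda>i. S (?e i)) ` {..<m})" for y
    proof -
      have "y = S (tail (S' y) + trunc_ell2 m (S' y))"
        by (simp add: split[symmetric] SS')
      also have "\<dots> = W (tail (S' y)) + (\<Sum>i<m. ell2_nth (S' y) i *\<^sub>C S (?e i))"
        by (simp add: lin(1)[OF S] W_tail apply_trunc[OF S])
      also have "\<dots> \<in> ell2.span (range W \<union> (\<lambda>i. S (?e i)) ` {..<m})"
        by (intro ell2.span_add ell2.span_sum ell2.span_scale ell2.span_base) auto
      finally show ?thesis .
    qed
    then show ?thesis by blast
  qed
  then have "\<exists>B. finite B \<and> ell2.span (range W \<union> B) = UNIV"
    by (metis finite_imageI finite_lessThan)
  ultimately show ?thesis
    using W by (simp add: fredholm_def)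
qed

section \<open>Symmetric operators with arbitrarily small columns\<close>

text \<open>By symmetry, row \<open>i\<close> of the matrix of \<open>W\<close> is its column \<open>i\<close>, that is, \<open>W e\<^sub>i\<close>. So the \<open>i\<close>-th coordinate
  of \<open>W u\<close> is a product of \<open>u\<close> with \<open>W e\<^sub>i\<close>, and the Cauchy-Schwarz inequality applies. The inner product
  at hand is only the real part of the complex one, and a factor \<open>c\<close> that turns the coordinate into its modulus makes up for this.\<close>

lemma symmetric_matrix_nth_bound:
  assumes W: "bounded_clinear W"
    and M: "\<And>i j. ell2_nth (W (unit_ell2 j)) i = complex_of_real (M i j)"
    and sym: "\<And>i j. M i j = M j i"
  shows "cmod (ell2_nth (W u) i) \<le> norm u * norm (W (unit_ell2 i))"
proof -
  let ?w = "ell2_nth (W u) i"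
  define c where "c = cnj (sgn ?w)"
  have c: "cmod c \<le> 1"
    by (simp add: c_def norm_sgn)
  have "c * ?w = complex_of_real (cmod ?w)"
    by (simp add: c_def sgn_eq complex_norm_square[symmetric] power2_eq_square field_simps)
  then have "cmod ?w = Re (c * ?w)"
    by simp
  moreover have "(\<lambda>j. Re (c * (ell2_nth u j * complex_of_real (M i j)))) sums Re (c * ?w)"
    using bounded_clinear_nth_sums[OF W, of u i] unfolding M by (intro sums_Re sums_mult)
  moreover have "Re (c * (ell2_nth u j * complex_of_real (M i j)))
      = inner (ell2_nth (c *\<^sub>C u) j) (ell2_nth (W (unit_ell2 i)) j)" for j
    by (simp add: M sym[of i j] inner_complex_def algebra_simps)
  ultimately have "cmod ?w = inner (c *\<^sub>C u) (W (unit_ell2 i))"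
    unfolding inner_ell2_def by (simp add: sums_iff)
  also have "\<dots> \<le> norm (c *\<^sub>C u) * norm (W (unit_ell2 i))"
    by (rule norm_cauchy_schwarz)
  also have "\<dots> \<le> norm u * norm (W (unit_ell2 i))"
    using c by (intro mult_right_mono) (simp_all add: norm_scaleC mult_left_le_one_le)
  finally show ?thesis .
qed

text \<open>The basis vectors with small columns form a singular Weyl sequence. What they give here is that the range has
  infinite codimension: all its elements decay fast along suitable coordinates.\<close>

lemma not_fredholm_if_small_columns:
  assumes W: "bounded_clinear W"
    and M: "\<And>i j. ell2_nth (W (unit_ell2 j)) i = complex_of_real (M i j)"
    and sym: "\<And>i j. M i j = M j i"
    and small: "\<And>r N. 0 < r \<Longrightarrow> \<exists>i\<ge>N. norm (W (unit_ell2 i)) < r"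
  shows "\<not> fredholm W"
proof
  assume "fredholm W"
  then obtain B where B: "finite B" "ell2.span (range W \<union> B) = UNIV"
    by (auto simp: fredholm_def)

  have "\<exists>p. \<forall>k. norm (W (unit_ell2 (p k))) < (1/4) ^ k \<and> p k < p (Suc k)"
  proof (rule dependent_nat_choice)
    show "\<exists>i. norm (W (unit_ell2 i)) < (1/4) ^ 0"
      using small[of 1 0] by auto
    show "\<exists>j. norm (W (unit_ell2 j)) < (1/4) ^ Suc k \<and> i < j" for i k
      using small[of "(1/4) ^ Suc k" "Suc i"] by (auto simp: Suc_le_eq)
  qed
  then obtain p where p: "\<And>k. norm (W (unit_ell2 (p k))) < (1/4) ^ k" "\<And>k. p k < p (Suc k)"
    by blast
  have mono: "strict_mono p"
    using p(2) by (simp add: strict_mono_Suc_iff)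
  then have inj: "p k = p l \<longleftrightarrow> k = l" for k l
    by (simp add: strict_mono_eq)

  define R where "R = {y. \<exists>C. \<forall>k. cmod (ell2_nth y (p k)) \<le> C * (1/4) ^ k}"
  have range_W: "range W \<subseteq> R"
  proof -
    have "cmod (ell2_nth (W u) (p k)) \<le> norm u * (1/4) ^ k" for u k
      using symmetric_matrix_nth_bound[OF W M sym, of u "p k"] p(1)[of k]
      by (meson less_eq_real_def mult_left_mono norm_ge_zero order_trans)
    then show ?thesis by (auto simp: R_def)
  qed
  have R: "ell2.subspace R"
  proof (rule ell2.subspaceI)
    show "0 \<in> R" by (auto simp: R_def intro!: exI[of _ 0])
  next
    fix x y assume "x \<in> R" "y \<in> R"
    then obtain C D where CD: "\<And>k. cmod (ell2_nth x (p k)) \<le> C * (1/4) ^ k"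
        "\<And>k. cmod (ell2_nth y (p k)) \<le> D * (1/4) ^ k"
      by (auto simp: R_def)
    have "cmod (ell2_nth (x + y) (p k)) \<le> (C + D) * (1/4) ^ k" for k
      using norm_triangle_ineq[of "ell2_nth x (p k)" "ell2_nth y (p k)"] CD(1)[of k] CD(2)[of k]
      by (simp only: ell2_nth_simps distrib_right)
    then show "x + y \<in> R" by (auto simp: R_def)
  next
    fix c x assume "x \<in> R"
    then obtain C where C: "\<And>k. cmod (ell2_nth x (p k)) \<le> C * (1/4) ^ k"
      by (auto simp: R_def)
    have "cmod (ell2_nth (c *\<^sub>C x) (p k)) \<le> (cmod c * C) * (1/4) ^ k" for k
      using mult_left_mono[OF C[of k], of "cmod c"] by (simp add: norm_mult mult.assoc)
    then show "c *\<^sub>C x \<in> R" by (auto simp: R_def)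
  qed

  \<comment> \<open>Pair decoding splits the indices \<open>k\<close> into infinitely many infinite classes. The vector for class \<open>j\<close> decays like \<open>2\<^sup>-\<^sup>k\<close> along it, and this is too slow for \<open>R\<close>.\<close>
  have "\<exists>y. \<forall>k. ell2_nth y (p k) = (if fst (prod_decode k) = j then (1/2) ^ k else 0)" for j
  proof -
    define f :: "nat \<Rightarrow> complex" where
      "f i = (if i \<in> range p \<and> fst (prod_decode (the_inv p i)) = j then (1/2) ^ the_inv p i else 0)" for i
    have f: "f (p k) = (if fst (prod_decode k) = j then (1/2) ^ k else 0)" for k
      using strict_mono_imp_inj_on[OF mono] by (simp add: f_def the_inv_f_f)
    have "summable (\<lambda>k. (cmod (f (p k)))\<^sup>2)"
    proof (rule summable_comparison_test')
      show "summable (\<lambda>k. (1/4 :: real) ^ k)" by (rule summable_geometric) simp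
      show "norm ((cmod (f (p k)))\<^sup>2) \<le> (1/4) ^ k" for k
        by (simp add: f norm_power power_mult[symmetric] mult.commute[of k]) 
          (simp add: power_mult power2_eq_square)
    qed
    then have "summable (\<lambda>i. (cmod (f i))\<^sup>2)"
      using summable_mono_reindex[OF mono, of "\<lambda>i. (cmod (f i))\<^sup>2"] by (auto simp: f_def)
    then show ?thesis using f by (metis ex_ell2)
  qed
  then obtain y where
    y: "\<And>j k. ell2_nth (y j) (p k) = (if fst (prod_decode k) = j then (1/2) ^ k else 0)"
    by metis

  have "c j = 0" if J: "finite J" "(\<Sum>j\<in>J. c j *\<^sub>C y j) \<in> R" "j \<in> J" for J c j
  proof -
    obtain C where C: "\<And>k. cmod (ell2_nth (\<Sum>j\<in>J. c j *\<^sub>C y j) (p k)) \<le> C * (1/4) ^ k"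
      using J(2) by (auto simp: R_def)
    \<comment> \<open>Only the summand with index \<open>j\<close> contributes at the coordinates of class \<open>j\<close>; let these tend to infinity.\<close>
    have le: "cmod (c j) \<le> C * (1/2) ^ k" if k: "fst (prod_decode k) = j" for k
    proof -
      have "ell2_nth (\<Sum>j\<in>J. c j *\<^sub>C y j) (p k) = (\<Sum>i\<in>J. if i = j then c j * (1/2) ^ k else 0)"
        unfolding ell2_nth_sum by (rule sum.cong) (auto simp: y k)
      also have "\<dots> = c j * (1/2) ^ k"
        using J by simp
      finally have "cmod (c j) * (1/2) ^ k \<le> C * ((1/2) ^ k * (1/2) ^ k)"
        using C[of k] by (simp add: norm_mult norm_power power_mult_distrib[symmetric])
      then show ?thesis by simp
    qed
    have "(\<lambda>t. C * (1/2) ^ prod_encode (j, t)) \<longlonglongrightarrow> C * 0"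
    proof (intro tendsto_mult_left)
      have "filterlim (\<lambda>t. prod_encode (j, t)) sequentially sequentially"
        by (rule filterlim_at_top_mono[OF filterlim_ident]) (simp add: le_prod_encode_2)
      then show "(\<lambda>t. (1/2 :: real) ^ prod_encode (j, t)) \<longlonglongrightarrow> 0"
        by (rule filterlim_compose[OF LIMSEQ_power_zero, rotated]) simp
    qed
    then have "cmod (c j) \<le> C * 0"
      by (rule LIMSEQ_le_const) (auto intro!: le)
    then show ?thesis by simp
  qed
  then have "ell2.span (R \<union> B) \<noteq> UNIV"
    by (rule infinite_codimension[OF R _ B(1)])
  moreover have "ell2.span (range W \<union> B) \<subseteq> ell2.span (R \<union> B)"
    using range_W by (intro ell2.span_mono) auto
  ultimately show False using B by blast
qed

section \<open>Compact perturbations of a diagonal operator\<close>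

lemma ex_diagonal_operator:
  fixes d :: "nat \<Rightarrow> complex"
  assumes "\<And>i. cmod (d i) \<le> K"
  obtains D where "bounded_clinear D" "\<And>x i. ell2_nth (D x) i = d i * ell2_nth x i"
proof -
  have le: "cmod (d i * ell2_nth x i) \<le> \<bar>K\<bar> * cmod (ell2_nth x i)" for x i
    using assms[of i] by (auto simp: norm_mult intro!: mult_right_mono)
  have "summable (\<lambda>i. (cmod (d i * ell2_nth x i))\<^sup>2)" for x
  proof (rule summable_comparison_test')
    show "summable (\<lambda>i. \<bar>K\<bar>\<^sup>2 * (cmod (ell2_nth x i))\<^sup>2)"
      by (intro summable_mult summable_ell2)
    show "norm ((cmod (d i * ell2_nth x i))\<^sup>2) \<le> \<bar>K\<bar>\<^sup>2 * (cmod (ell2_nth x i))\<^sup>2" for i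
      using power_mono[OF le[of i x], of 2] by (simp add: power_mult_distrib)
  qed
  then have "\<exists>y. ell2_nth y = (\<lambda>i. d i * ell2_nth x i)" for x
    by (metis ex_ell2)
  then obtain D where D: "\<And>x. ell2_nth (D x) = (\<lambda>i. d i * ell2_nth x i)"
    by metis
  have "bounded_clinear D"
  proof (rule bounded_clinearI)
    show "norm (D x) \<le> \<bar>K\<bar> * norm x" for x
      by (rule norm_ell2_mono) (use le in \<open>auto simp: D\<close>)
  qed (auto intro!: ell2_eqI simp: D algebra_simps)
  then show ?thesis using that D by simp
qed

text \<open>The operator \<open>A\<close> is diagonal outside a finite block, and \<open>T\<close> is a perturbation of it that is smaller
  than the distance \<open>\<epsilon>\<close> from \<open>z\<close> to the diagonal entries beyond the block.\<close>

lemma fredholm_if_diagonal_tail_bounded_below: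
  fixes lam :: "nat \<Rightarrow> complex"
  assumes T: "bounded_clinear T" and A: "bounded_clinear A"
    and diag: "\<And>j. m \<le> j \<Longrightarrow> A (unit_ell2 j) = lam j *\<^sub>C unit_ell2 j"
    and lam: "\<And>i. cmod (lam i) \<le> K"
    and far: "\<And>i. m \<le> i \<Longrightarrow> \<epsilon> \<le> cmod (lam i - z)" and "0 < \<epsilon>"
    and close: "onorm (\<lambda>x. A x - T x) < \<epsilon>"
  shows "fredholm (\<lambda>x. T x - z *\<^sub>C x)"
proof -
  have diag': "ell2_nth (A x) i = lam i * ell2_nth x i"
    if "\<And>k. k < m \<Longrightarrow> ell2_nth x k = 0" for x i
  proof -
    have "ell2_nth x j * ell2_nth (A (unit_ell2 j)) i = (if j = i then lam i * ell2_nth x i else 0)" for j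
      using that[of j] diag[of j] by (cases "j < m") auto
    then have "(\<lambda>j. if j = i then lam i * ell2_nth x i else 0) sums ell2_nth (A x) i"
      using bounded_clinear_nth_sums[OF A, of x i] by simp
    then show ?thesis
      using sums_single[of i "\<lambda>_. lam i * ell2_nth x i"] sums_unique2 by blast
  qed
  \<comment> \<open>On the finite block any entry of modulus at least \<open>\<epsilon>\<close> would do, as the block does not affect the Fredholm property.\<close>
  define d where "d i = (if i < m then complex_of_real \<epsilon> else lam i - z)" for i
  have d: "\<epsilon> \<le> cmod (d i)" for i
    using far \<open>0 < \<epsilon>\<close> by (simp add: d_def)
  have d0: "d i \<noteq> 0" for i
    using d[of i] \<open>0 < \<epsilon>\<close> by auto
  have "cmod (d i) \<le> \<epsilon> + K + cmod z" for i
  proof -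
    have "0 \<le> K" using lam[of 0] norm_ge_zero order_trans by blast
    then show ?thesis
      using norm_triangle_ineq4[of "lam i" z] lam[of i] \<open>0 < \<epsilon>\<close> by (auto simp: d_def)
  qed
  then obtain L where L: "bounded_clinear L" "\<And>x i. ell2_nth (L x) i = d i * ell2_nth x i"
    using ex_diagonal_operator by blast
  have inv_d: "cmod (inverse (d i)) \<le> 1 / \<epsilon>" for i
    using le_imp_inverse_le[OF d[of i] \<open>0 < \<epsilon>\<close>] by (simp add: norm_inverse norm_divide inverse_eq_divide)
  obtain R where R: "bounded_clinear R" "\<And>x i. ell2_nth (R x) i = inverse (d i) * ell2_nth x i"
    using ex_diagonal_operator[of "\<lambda>i. inverse (d i)", OF inv_d] by blast
  define E where "E x = T x - A x" for x
  have E: "bounded_clinear E"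
    unfolding E_def by (rule bounded_clinear_sub[OF T A])
  let ?\<delta> = "onorm (\<lambda>x. A x - T x)"
  have bl: "bounded_linear (\<lambda>x. A x - T x)"
    by (intro bounded_linear_sub bounded_clinear_bounded_linear A T)
  have "\<exists>S'. bounded_clinear S' \<and> (\<forall>y. L (S' y) + E (S' y) = y) \<and> (\<forall>x. S' (L x + E x) = x)"
  proof (rule invertible_perturbation[OF L(1) R(1) _ _ _ E])
    show "L (R x) = x" "R (L x) = x" for x
      by (auto intro!: ell2_eqI simp: L R d0)
    have "norm (R x) \<le> 1 / \<epsilon> * norm x" for x
    proof (rule norm_ell2_mono)
      show "cmod (ell2_nth (R x) i) \<le> 1 / \<epsilon> * cmod (ell2_nth x i)" for i
        unfolding R(2) norm_mult by (rule mult_right_mono[OF inv_d norm_ge_zero])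
    qed (use \<open>0 < \<epsilon>\<close> in simp)
    then show "\<epsilon> * norm (R x) \<le> norm x" for x
      using \<open>0 < \<epsilon>\<close> by (simp add: field_simps)
    show "norm (E x) \<le> ?\<delta> * norm x" for x
      using onorm[OF bl, of x] by (simp add: E_def norm_minus_commute)
    show "0 \<le> ?\<delta>" by (rule onorm_pos_le[OF bl])
  qed fact
  then obtain S' where S': "bounded_clinear S'" "\<And>y. L (S' y) + E (S' y) = y" "\<And>x. S' (L x + E x) = x"
    by blast
  have LE: "bounded_clinear (\<lambda>x. L x + E x)"
    using L(1) E by (intro bounded_clinear_if_bounded_linear bounded_linear_add)
      (simp_all add: bounded_clinear_add bounded_clinear_scaleC bounded_clinear_bounded_linear
        ell2.scale_right_distrib)
  show ?thesis
  proof (rule fredholm_if_agrees_with_invertible[OF _ LE S', where m = m])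
    show "bounded_clinear (\<lambda>x. T x - z *\<^sub>C x)"
      by (intro bounded_clinear_sub T bounded_clinear_scaleC_right)
    fix x assume x: "\<And>i. i < m \<Longrightarrow> ell2_nth x i = 0"
    show "T x - z *\<^sub>C x = L x + E x"
      by (rule ell2_eqI) (auto simp: E_def L d_def diag'[OF x] x algebra_simps)
  qed
qed

section \<open>Essential spectrum of a constructed solution\<close>

text \<open>The defining data of a constructed solution are usable only from index 1 on, so the approximants
  are shifted: \<open>U n\<close> has a leading block of size \<open>n + 1\<close> and is diagonal in the columns with index
  greater than \<open>n\<close>.\<close>

lemma constructed_solution_approximants:
  assumes "constructed_solution G \<Lambda> T"
  obtains lam U a where "inj lam" "range lam \<subseteq> \<Lambda>" "\<Lambda> \<subseteq> closure (range lam)"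
    and "bounded_clinear T" "\<And>n. has_matrix (U n) (a n)"
    and "\<And>n i j. a n i j = a n j i" "\<And>n i j. n < j \<Longrightarrow> a n i j = (if i = j then lam i else 0)"
    and "(\<lambda>n. onorm (\<lambda>x. U n x - T x)) \<longlonglongrightarrow> 0"
proof -
  from assms obtain lam A Ts where lam: "inj lam" "range lam \<subseteq> \<Lambda>" "\<Lambda> \<subseteq> closure (range lam)"
    and A: "\<And>n. n \<ge> 1 \<Longrightarrow> A n \<in> carrier_mat n n \<and> transpose_mat (A n) = A n
        \<and> has_matrix (Ts n) (diag_extension n (A n) lam)"
    and T: "bounded_clinear T" "(\<lambda>n. onorm (\<lambda>x. Ts n x - T x)) \<longlonglongrightarrow> 0"
    unfolding constructed_solution_def
  proof (elim exE conjE, goal_cases)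
    case (1 lam A Ts)
    show ?case by (rule 1(1)[OF 1(2-4) _ 1(7,8), of A]) (use 1(6) in simp)
  qed
  have "A n $$ (i, j) = A n $$ (j, i)" if "n \<ge> 1" "i < n" "j < n" for n i j
  proof -
    have "A n $$ (i, j) = transpose_mat (A n) $$ (i, j)"
      using A that by simp
    also have "\<dots> = A n $$ (j, i)"
      using A[OF \<open>n \<ge> 1\<close>] that by (intro index_transpose_mat) auto
    finally show ?thesis .
  qed
  then show ?thesis
    using A T(2)[THEN LIMSEQ_Suc]
    by (intro that[OF lam T(1), of "\<lambda>n. Ts (Suc n)" "\<lambda>n. diag_extension (Suc n) (A (Suc n)) lam"])
      (auto simp: diag_extension_def)
qed

theorem corollary4p7:
  fixes G :: "nat \<Rightarrow> nat \<Rightarrow> bool" and \<Lambda> :: "real set" and T :: "ell2 \<Rightarrow> ell2"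
  assumes "simple_graph G"
    and "compact \<Lambda>" and "infinite \<Lambda>"
    and "constructed_solution G \<Lambda> T"
  shows "essential_spectrum T = complex_of_real ` {x. x islimpt \<Lambda>}"
proof -
  obtain lam U a where lam: "inj lam" "range lam \<subseteq> \<Lambda>" "\<Lambda> \<subseteq> closure (range lam)"
    and T: "bounded_clinear T" and mat: "\<And>n. has_matrix (U n) (a n)"
    and sym: "\<And>n i j. a n i j = a n j i"
    and diag: "\<And>n i j. n < j \<Longrightarrow> a n i j = (if i = j then lam i else 0)"
    and lim: "(\<lambda>n. onorm (\<lambda>x. U n x - T x)) \<longlonglongrightarrow> 0"
  proof (rule constructed_solution_approximants[OF assms(4)], goal_cases)
    case (1 lam U a)
    show ?case by (rule 1(1)[OF 1(2-9)])
  qed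
  let ?e = unit_ell2
  have U: "bounded_clinear (U n)" and U_nth: "ell2_nth (U n (?e j)) i = complex_of_real (a n i j)"
    for n i j
    using mat[of n] by (auto simp: has_matrix_def)
  have U_diag: "U n (?e j) = complex_of_real (lam j) *\<^sub>C ?e j" if "n < j" for n j
    by (rule ell2_eqI) (simp add: U_nth diag[OF that])
  have bl: "bounded_linear (\<lambda>x. U n x - T x)" for n
    by (intro bounded_linear_sub bounded_clinear_bounded_linear U T)
  have avoid: "\<exists>N. \<forall>i\<ge>N. lam i \<noteq> x" for x
    using lam(1) by (metis injD Suc_n_not_le_n)

  have "complex_of_real x \<in> essential_spectrum T" if x: "x islimpt \<Lambda>" for x
  proof -
    define W where "W u = T u - complex_of_real x *\<^sub>C u" for u
    have "\<not> fredholm W"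
    proof (rule not_fredholm_if_small_columns)
      show "bounded_clinear W"
        unfolding W_def by (intro bounded_clinear_sub T bounded_clinear_scaleC_right)
      have conv: "(\<lambda>n. complex_of_real (a n i j)) \<longlonglongrightarrow> ell2_nth (T (?e j)) i" for i j
      proof (rule Lim_null_comparison[THEN LIM_zero_cancel])
        have "cmod (complex_of_real (a n i j) - ell2_nth (T (?e j)) i) \<le> onorm (\<lambda>x. U n x - T x)" for n
          using cmod_nth_le_norm[of "U n (?e j) - T (?e j)" i] onorm[OF bl, of n "?e j"]
          by (simp add: U_nth norm_unit_ell2)
        then show "\<forall>\<^sub>F n in sequentially. norm (complex_of_real (a n i j) - ell2_nth (T (?e j)) i)
            \<le> onorm (\<lambda>x. U n x - T x)"
          by simp
      qed (rule lim)
      have conv_Re: "(\<lambda>n. a n i j) \<longlonglongrightarrow> Re (ell2_nth (T (?e j)) i)" for i j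
        using tendsto_Re[OF conv] by simp
      have real: "Im (ell2_nth (T (?e j)) i) = 0" for i j
        using tendsto_Im[OF conv] by (simp add: LIMSEQ_const_iff)
      show "ell2_nth (W (?e j)) i
          = complex_of_real (Re (ell2_nth (T (?e j)) i) - (if i = j then x else 0))" for i j
        by (simp add: W_def complex_eq_iff real)
      have "Re (ell2_nth (T (?e j)) i) = Re (ell2_nth (T (?e i)) j)" for i j
        using conv_Re[of i j] conv_Re[of j i] sym[of _ i j] LIMSEQ_unique by simp
      then show "Re (ell2_nth (T (?e j)) i) - (if i = j then x else 0)
          = Re (ell2_nth (T (?e i)) j) - (if j = i then x else 0)" for i j
        by auto
      fix r :: real and N :: nat assume "0 < r"
      then have "\<forall>\<^sub>F n in sequentially. onorm (\<lambda>x. U n x - T x) < r / 2"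
        by (intro order_tendstoD(2)[OF lim]) simp
      then obtain n where n: "onorm (\<lambda>x. U n x - T x) < r / 2"
        using eventually_happens by fastforce
      have "x islimpt range lam"
        using islimpt_subset[OF x lam(3)] by (simp add: limpt_of_closure)
      then have "infinite (range lam \<inter> ball x (r / 2))"
        using \<open>0 < r\<close> by (simp add: islimpt_eq_infinite_ball)
      moreover have "range lam \<inter> ball x (r / 2) \<subseteq> lam ` {i. \<bar>lam i - x\<bar> < r / 2}"
        by (auto simp: dist_real_def abs_minus_commute)
      ultimately have "infinite {i. \<bar>lam i - x\<bar> < r / 2}"
        using finite_surj by blast
      then obtain i where i: "i \<ge> max N (Suc n)" "\<bar>lam i - x\<bar> < r / 2"
        unfolding infinite_nat_iff_unbounded_le by blast
      have "W (?e i) = complex_of_real (lam i - x) *\<^sub>C ?e i - (U n (?e i) - T (?e i))"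
        using i by (intro ell2_eqI) (simp add: W_def U_diag algebra_simps)
      then have "norm (W (?e i)) \<le> \<bar>lam i - x\<bar> + onorm (\<lambda>x. U n x - T x)"
        using norm_triangle_ineq4[of "complex_of_real (lam i - x) *\<^sub>C ?e i" "U n (?e i) - T (?e i)"]
          onorm[OF bl, of n "?e i"]
        by (simp only: norm_scaleC norm_unit_ell2 norm_of_real mult_1_right)
      then show "\<exists>i\<ge>N. norm (W (?e i)) < r"
        using i n by (intro exI[of _ i]) auto
    qed
    then show ?thesis
      by (simp add: essential_spectrum_def W_def[abs_def])
  qed

  moreover have "fredholm (\<lambda>x. T x - z *\<^sub>C x)" if z: "z \<notin> complex_of_real ` {x. x islimpt \<Lambda>}" for z
  proof -
    have "\<exists>\<epsilon>>0. \<forall>i. complex_of_real (lam i) \<noteq> z \<longrightarrow> \<epsilon> \<le> cmod (complex_of_real (lam i) - z)"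
    proof (cases "z \<in> \<real>")
      case True
      then obtain x where x: "z = complex_of_real x" by (auto elim: Reals_cases)
      then have "\<not> x islimpt range lam"
        using z lam(2) islimpt_subset by blast
      then obtain \<epsilon> where "\<epsilon> > 0" "\<And>i. lam i \<noteq> x \<Longrightarrow> \<epsilon> \<le> \<bar>lam i - x\<bar>"
        by (auto simp: islimpt_approachable dist_real_def not_less)
      then show ?thesis
        by (auto simp: x simp flip: of_real_diff)
    next
      case False
      then have "Im z \<noteq> 0" by (simp add: complex_is_Real_iff)
      then show ?thesis
        using abs_Im_le_cmod[of "complex_of_real (lam _) - z"] by (intro exI[of _ "\<bar>Im z\<bar>"]) auto
    qed
    then obtain \<epsilon> where "\<epsilon> > 0"
      and \<epsilon>: "\<And>i. complex_of_real (lam i) \<noteq> z \<Longrightarrow> \<epsilon> \<le> cmod (complex_of_real (lam i) - z)"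
      by blast
    \<comment> \<open>The point \<open>z\<close> may itself be one of the \<open>\<lambda>\<^sub>i\<close>, an isolated one; it is taken once and lands in the finite block.\<close>
    obtain N where N: "\<And>i. i \<ge> N \<Longrightarrow> lam i \<noteq> Re z"
      using avoid by blast
    have "\<forall>\<^sub>F n in sequentially. onorm (\<lambda>x. U n x - T x) < \<epsilon> \<and> n \<ge> N"
      using \<open>\<epsilon> > 0\<close> by (intro eventually_conj order_tendstoD(2)[OF lim] eventually_ge_at_top)
    then obtain n where n: "onorm (\<lambda>x. U n x - T x) < \<epsilon>" "n \<ge> N"
      using eventually_happens by fastforce
    obtain K where K: "\<And>i. cmod (complex_of_real (lam i)) \<le> K"
      using compact_imp_bounded[OF assms(2)] lam(2) unfolding bounded_iff by force
    show ?thesis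
    proof (rule fredholm_if_diagonal_tail_bounded_below[OF T U _ K _ \<open>\<epsilon> > 0\<close> n(1)])
      show "U n (?e j) = complex_of_real (lam j) *\<^sub>C ?e j" if "Suc n \<le> j" for j
        using that by (simp add: U_diag)
      show "\<epsilon> \<le> cmod (complex_of_real (lam i) - z)" if "Suc n \<le> i" for i
        using that n(2) N[of i] by (intro \<epsilon>) auto
    qed
  qed
  ultimately show ?thesis
    by (auto simp: essential_spectrum_def)
qed

end
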